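(* Let $\nu\in\mathbb M$ be ergodic with respect to $\mathbb S\times\mathbb O$ and aperiodic. Then for every $k\ge0$ and all distinct $r_1,r_2\in\{0,\dots,2^k-1\}$, the measures $\mathcal P_{r_1,k}[\nu]$ and $\mathcal P_{r_2,k}[\nu]$ are mutually singular.
   Context: $I=\{0,1\}$. $\mathbb S$ is the left shift on $I^{\mathbb Z}$; $\mathbb S^j\eta$ denotes pushforward. $I^{\mathbb N}$ is the space of $0$–$1$ sequences $(\alpha_i)_{i\ge1}$ with uniform Bernoulli measure $m$; $\mathbb O$ is the odometer (if $\alpha_1=\dots=\alpha_{n-1}=1$, $\alpha_n=0$, then $\mathbb O[\alpha]_i=0$ for $i<n$, $\mathbb O[\alpha]_n=1$, $\mathbb O[\alpha]_i=\alpha_i$ for $i>n$). $\mathbb M$ is the set of Borel probability measures on $I^{\mathbb Z}\times I^{\mathbb N}$ invariant under $\mathbb S\times\mathbb O$. $A_{r,k}=\{\alpha:\sum_{i=1}^k\alpha_i2^{i-1}=r\}$; $\mathcal P_{r,k}[\nu]$ is the normalized projection to $I^{\mathbb Z}$ of $\nu$ restricted to $I^{\mathbb Z}\times A_{r,k}$. For $k\ge0$ and an $\mathbb S^{2^k}$-invariant Borel probability measure $\eta$ on $I^{\mathbb Z}$, $D_k[\eta]=\sum_{i=0}^{2^k-1}\mathbb S^i\eta\times(\chi_{A_{i,k}}m)$. A measure $\nu\in\mathbb M$ is of periodic type if $\nu=D_k[\eta]$ for some $k\ge0$ and some $\mathbb S^{2^k}$-invariant $\eta$; otherwise it is aperiodic.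 *)

theory Defs
  imports "HOL-Probability.Probability"
begin

(* I^Z as int => bool with the product sigma algebra (= Borel for the product topology) *)
definition XZ :: "(int \<Rightarrow> bool) measure" where
  "XZ = PiM UNIV (\<lambda>_. count_space UNIV)"

(* I^N: sequences (alpha_1, alpha_2, ...) stored 0-indexed: a i = alpha_(i+1) *)
definition XN :: "(nat \<Rightarrow> bool) measure" where
  "XN = PiM UNIV (\<lambda>_. count_space UNIV)"

definition bern :: "(nat \<Rightarrow> bool) measure" where
  "bern = PiM UNIV (\<lambda>_. measure_pmf (bernoulli_pmf (1/2)))"

definition shiftS :: "(int \<Rightarrow> bool) \<Rightarrow> (int \<Rightarrow> bool)" where
  "shiftS x = (\<lambda>i. x (i + 1))"

(* odometer (adding 1 with carry); the all-ones sequence (a null set) goes to all zeros *)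
definition odo :: "(nat \<Rightarrow> bool) \<Rightarrow> (nat \<Rightarrow> bool)" where
  "odo a = (if \<exists>n. \<not> a n then
      (let n = (LEAST n. \<not> a n) in (\<lambda>i. if i < n then False else if i = n then True else a i))
    else (\<lambda>_. False))"

definition TSO :: "(int \<Rightarrow> bool) \<times> (nat \<Rightarrow> bool) \<Rightarrow> (int \<Rightarrow> bool) \<times> (nat \<Rightarrow> bool)" where
  "TSO = map_prod shiftS odo"

definition Ark :: "nat \<Rightarrow> nat \<Rightarrow> (nat \<Rightarrow> bool) set" where
  "Ark r k = {a. (\<Sum>i<k. (if a i then 1 else 0) * 2 ^ i) = r}"

definition MM :: "((int \<Rightarrow> bool) \<times> (nat \<Rightarrow> bool)) measure set" where
  "MM = {\<nu>. prob_space \<nu> \<and> sets \<nu> = sets (XZ \<Otimes>\<^sub>M XN) \<and> distr \<nu> (XZ \<Otimes>\<^sub>M XN) TSO = \<nu>}"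

definition ergodic_SO :: "((int \<Rightarrow> bool) \<times> (nat \<Rightarrow> bool)) measure \<Rightarrow> bool" where
  "ergodic_SO \<nu> \<longleftrightarrow> (\<forall>C \<in> sets \<nu>. TSO -` C \<inter> space \<nu> = C \<longrightarrow>
      emeasure \<nu> C = 0 \<or> emeasure \<nu> C = 1)"

definition Dk_emeasure :: "nat \<Rightarrow> (int \<Rightarrow> bool) measure \<Rightarrow> ((int \<Rightarrow> bool) \<times> (nat \<Rightarrow> bool)) set \<Rightarrow> ennreal" where
  "Dk_emeasure k \<eta> C = (\<Sum>i<2^k. emeasure (distr \<eta> XZ (shiftS ^^ i) \<Otimes>\<^sub>M density bern (indicator (Ark i k))) C)"

definition periodic_type :: "((int \<Rightarrow> bool) \<times> (nat \<Rightarrow> bool)) measure \<Rightarrow> bool" where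
  "periodic_type \<nu> \<longleftrightarrow> (\<exists>k \<eta>. prob_space \<eta> \<and> sets \<eta> = sets XZ \<and>
      distr \<eta> XZ (shiftS ^^ (2^k)) = \<eta> \<and>
      (\<forall>C \<in> sets (XZ \<Otimes>\<^sub>M XN). emeasure \<nu> C = Dk_emeasure k \<eta> C))"

definition aperiodic :: "((int \<Rightarrow> bool) \<times> (nat \<Rightarrow> bool)) measure \<Rightarrow> bool" where
  "aperiodic \<nu> \<longleftrightarrow> \<not> periodic_type \<nu>"

definition Proj :: "nat \<Rightarrow> nat \<Rightarrow> ((int \<Rightarrow> bool) \<times> (nat \<Rightarrow> bool)) measure \<Rightarrow> (int \<Rightarrow> bool) measure" where
  "Proj r k \<nu> = distr (density \<nu> (\<lambda>z. indicator (UNIV \<times> Ark r k) z / emeasure \<nu> (UNIV \<times> Ark r k))) XZ fst"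

definition mutually_singular :: "'a measure \<Rightarrow> 'a measure \<Rightarrow> bool" where
  "mutually_singular \<mu>1 \<mu>2 \<longleftrightarrow> (\<exists>C \<in> sets \<mu>1. emeasure \<mu>1 C = 0 \<and> emeasure \<mu>2 (space \<mu>2 - C) = 0)"

end

theory Submission
  imports Defs
begin

text \<open>
  Write \<open>Q k r\<close> for the projection to \<open>I^Z\<close> of the part of \<open>\<nu>\<close> over \<open>A r k\<close>, of total mass \<open>2^-k\<close>.
  Ergodicity of \<open>\<nu>\<close> makes each \<open>Q k r\<close> ergodic under the \<open>2^k\<close>-th power of the shift, so two of
  them are equal or mutually singular. Suppose \<open>Q k r1 = Q k r2\<close> with \<open>r1 \<noteq> r2\<close>. Since the shift
  maps \<open>Q k r\<close> to \<open>Q k (r + 1)\<close>, the family \<open>Q k\<close> has a period \<open>d\<close> with \<open>0 < d < 2^k\<close>, and a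
  multiple of \<open>d\<close> is congruent to \<open>2^(k-1)\<close>; hence \<open>Q (k-1) r = 2 Q k r\<close>. Such a coincidence
  propagates to every level \<open>l \<ge> k\<close>: were the \<open>Q (l+1) s\<close> pairwise singular, so would be the
  \<open>Q l r\<close>, each being a sum of two of them. Therefore \<open>Q l s\<close> is \<open>2^(k-1-l)\<close> times
  \<open>Q (k-1) (s mod 2^(k-1))\<close> for all \<open>l \<ge> k\<close>, which says that \<open>\<nu>\<close> is \<open>D_(k-1)\<close> of the normalised
  \<open>Q (k-1) 0\<close>, contradicting aperiodicity.
\<close>

section \<open>Shift and odometer\<close>

text \<open>Integer exponents turn the powers of the shift into a group action, so that backward
  translates, which \<open>shiftS ^^ n\<close> does not provide, are available when a set is
  saturated.\<close>

definition shift_by :: "int \<Rightarrow> (int \<Rightarrow> bool) \<Rightarrow> (int \<Rightarrow> bool)" where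
  "shift_by j x = (\<lambda>i. x (i + j))"

text \<open>The residue modulo \<open>2 ^ k\<close> of the 2-adic integer with digits
  \<open>a\<close>. The sets \<open>Ark r k\<close> are its level sets, and the odometer acts on it
  by adding one.\<close>

definition dyadic_val :: "nat \<Rightarrow> (nat \<Rightarrow> bool) \<Rightarrow> nat" where
  "dyadic_val k a = (\<Sum>i<k. (if a i then 1 else 0) * 2 ^ i)"

lemma shift_by_add: "shift_by i (shift_by j x) = shift_by (i + j) x"
  by (simp add: shift_by_def algebra_simps)

lemma shift_by_0 [simp]: "shift_by 0 x = x"
  by (simp add: shift_by_def)

lemma shiftS_eq: "shiftS = shift_by 1"
  by (simp add: shiftS_def shift_by_def fun_eq_iff)

lemma shiftS_funpow: "shiftS ^^ n = shift_by (int n)"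
  by (induction n) (auto simp: shiftS_eq shift_by_add fun_eq_iff[where f = "_ \<circ> _"] fun_eq_iff[where f = id] add.commute)

lemma vimage_shift_by_add: "shift_by i -` (shift_by j -` D) = shift_by (i + j) -` D"
  by (auto simp: shift_by_add add.commute)

lemma space_XZ [simp]: "space XZ = UNIV" and space_XN [simp]: "space XN = UNIV"
  by (auto simp: XZ_def XN_def space_PiM)

lemma shift_by_measurable [measurable]: "shift_by j \<in> measurable XZ XZ"
  unfolding XZ_def shift_by_def by (rule measurable_PiM_single') (auto simp: space_PiM)

lemma shift_by_vimage_sets [measurable]: "D \<in> sets XZ \<Longrightarrow> shift_by j -` D \<in> sets XZ"
  using measurable_sets[OF shift_by_measurable, of D j] by simp

lemma Ark_eq: "Ark r k = {a. dyadic_val k a = r}"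
  by (simp add: Ark_def dyadic_val_def)

lemma dyadic_val_0 [simp]: "dyadic_val 0 a = 0"
  by (simp add: dyadic_val_def)

lemma dyadic_val_Suc: "dyadic_val (Suc k) a = dyadic_val k a + (if a k then 2 ^ k else 0)"
  by (simp add: dyadic_val_def)

lemma dyadic_val_less: "dyadic_val k a < 2 ^ k"
  by (induction k) (auto simp: dyadic_val_Suc)

text \<open>The digits at positions \<open>j\<close> to \<open>l - 1\<close> contribute only
  multiples of \<open>2 ^ j\<close>.\<close>

lemma dyadic_val_mod: "j \<le> l \<Longrightarrow> dyadic_val l a mod 2 ^ j = dyadic_val j a"
proof (induction l rule: dec_induct)
  case base
  then show ?case by (simp add: dyadic_val_less)
next
  case (step l)
  then have "(2::nat) ^ j dvd 2 ^ l" by (simp add: le_imp_power_dvd)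
  then have "(dyadic_val l a + (if a l then 2 ^ l else 0)) mod 2 ^ j = dyadic_val l a mod 2 ^ j"
    by (auto simp: mod_add_right_eq[symmetric, of _ "2^l"])
  then show ?case using step by (simp add: dyadic_val_Suc)
qed

lemma dyadic_val_eq_iff: "dyadic_val k a = dyadic_val k b \<longleftrightarrow> (\<forall>i<k. a i = b i)"
proof (induction k)
  case (Suc k)
  then show ?case
    using dyadic_val_less[of k a] dyadic_val_less[of k b]
    by (auto simp: dyadic_val_Suc less_Suc_eq)
qed simp

lemma dyadic_val_all_ones: "Suc (dyadic_val k a) = 2 ^ k \<longleftrightarrow> (\<forall>i<k. a i)"
proof -
  have "Suc (dyadic_val k (\<lambda>_. True)) = 2 ^ k"
    by (induction k) (auto simp: dyadic_val_Suc)
  then have "Suc (dyadic_val k a) = 2 ^ k \<longleftrightarrow> dyadic_val k a = dyadic_val k (\<lambda>_. True)"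
    by auto
  then show ?thesis by (simp add: dyadic_val_eq_iff)
qed

lemma ex_dyadic_val: "s < 2 ^ k \<Longrightarrow> \<exists>a. dyadic_val k a = s"
proof (induction k arbitrary: s)
  case (Suc k)
  have "s mod 2 ^ k < 2 ^ k" by simp
  from Suc.IH[OF this] obtain a where a: "dyadic_val k a = s mod 2 ^ k" by blast
  \<comment> \<open>The top digit of a number below \<open>2 ^ Suc k\<close> is one exactly when the
    number is at least \<open>2 ^ k\<close>.\<close>
  let ?b = "a(k := s \<ge> 2 ^ k)"
  have "dyadic_val k ?b = dyadic_val k a" by (subst dyadic_val_eq_iff) auto
  then have "dyadic_val (Suc k) ?b = s"
    using a Suc.prems by (auto simp: dyadic_val_Suc mod_if)
  then show ?case by blast
qed simp

text \<open>The odometer flips the digits up to and including the first zero: the carry into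
  position \<open>i\<close> is set iff all lower digits are one.\<close>

lemma odo_apply: "odo a i \<longleftrightarrow> a i \<noteq> (\<forall>m<i. a m)"
proof (cases "\<exists>n. \<not> a n")
  case True
  define n where "n = (LEAST n. \<not> a n)"
  have n: "\<not> a n" unfolding n_def using True by (rule LeastI_ex)
  have le: "m < n \<Longrightarrow> a m" for m unfolding n_def using not_less_Least by blast
  have "odo a i = (if i < n then False else if i = n then True else a i)"
    using True by (simp add: odo_def n_def Let_def)
  moreover have "(\<forall>m<i. a m) \<longleftrightarrow> i \<le> n" using n le by (meson leI less_le_trans not_le)
  ultimately show ?thesis using n le by auto
qed (auto simp: odo_def)

lemma dyadic_val_odo: "dyadic_val k (odo a) = Suc (dyadic_val k a) mod 2 ^ k"
proof (induction k)
  case (Suc k)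
  have lt: "Suc (dyadic_val k a) \<le> 2 ^ k" using dyadic_val_less[of k a] by simp
  show ?case
  proof (cases "\<forall>m<k. a m")
    \<comment> \<open>The carry reaches digit \<open>k\<close>: all lower digits become zero and
      digit \<open>k\<close> flips, so the residue wraps to zero exactly when digit \<open>k\<close>
      was one too.\<close>
    case True
    then have eq: "Suc (dyadic_val k a) = 2 ^ k" by (simp add: dyadic_val_all_ones)
    then have "Suc (dyadic_val (Suc k) a) = 2 ^ k + (if a k then 2 ^ k else 0)"
      by (simp add: dyadic_val_Suc)
    moreover have "dyadic_val (Suc k) (odo a) = (if a k then 0 else 2 ^ k)"
      using True eq Suc by (auto simp: dyadic_val_Suc[of k "odo a"] odo_apply[of a k])
    ultimately show ?thesis by (simp flip: mult_2)
  next
    case False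
    then have "Suc (dyadic_val k a) < 2 ^ k" using lt dyadic_val_all_ones[of k a] order_le_less by metis
    moreover from this have "Suc (dyadic_val (Suc k) a) < 2 ^ Suc k" by (simp add: dyadic_val_Suc)
    moreover have "odo a k = a k" using False by (auto simp: odo_apply)
    ultimately show ?thesis by (simp add: Suc dyadic_val_Suc)
  qed
qed simp

lemma odo_in_Ark_iff:
  assumes "r < 2 ^ k"
  shows "odo a \<in> Ark (Suc r mod 2 ^ k) k \<longleftrightarrow> a \<in> Ark r k"
proof -
  have "Suc x mod 2 ^ k = Suc r mod 2 ^ k \<Longrightarrow> x < 2 ^ k \<Longrightarrow> x = r" for x
    using assms by (auto simp: mod_Suc split: if_splits)
  then show ?thesis using dyadic_val_less[of k a] by (auto simp: Ark_eq dyadic_val_odo)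
qed

section \<open>Measurability of residues and odometer; cylinder sets\<close>

lemma XN_coord [measurable]: "(\<lambda>a. a i) \<in> measurable XN (count_space UNIV)"
  unfolding XN_def by (rule measurable_component_singleton) simp

lemma dyadic_val_measurable [measurable]: "dyadic_val k \<in> measurable XN (count_space UNIV)"
  unfolding dyadic_val_def by measurable

lemma Ark_sets [measurable]: "Ark r k \<in> sets XN"
proof -
  have "dyadic_val k -` {r} \<inter> space XN \<in> sets XN" by (rule measurable_sets[OF dyadic_val_measurable]) simp
  moreover have "dyadic_val k -` {r} = Ark r k" by (auto simp: Ark_eq)
  ultimately show ?thesis by simp
qed

lemma odo_measurable [measurable]: "odo \<in> measurable XN XN"
proof -
  have *: "(\<lambda>a. odo a i) \<in> measurable XN (count_space UNIV)" for i
    unfolding odo_apply by measurable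
  show ?thesis
    using * by (subst XN_def, intro measurable_PiM_single') (auto simp: space_PiM)
qed

lemma TSO_measurable [measurable]: "TSO \<in> measurable (XZ \<Otimes>\<^sub>M XN) (XZ \<Otimes>\<^sub>M XN)"
  unfolding TSO_def map_prod_def shiftS_eq by measurable

lemma Ark_disjoint: "r \<noteq> s \<Longrightarrow> Ark r k \<inter> Ark s k = {}"
  by (auto simp: Ark_eq)

lemma Ark_split:
  assumes "r < 2 ^ k"
  shows "Ark r k = Ark r (Suc k) \<union> Ark (r + 2 ^ k) (Suc k)"
proof -
  have "dyadic_val k a \<noteq> r + 2 ^ k" for a using dyadic_val_less[of k a] by simp
  then show ?thesis
    using assms dyadic_val_less[of k] by (auto simp: Ark_eq dyadic_val_Suc split: if_splits)
qed

lemma Ark_inter_coarser: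
  assumes "j \<le> l"
  shows "Ark s l \<inter> Ark i j = (if s mod 2 ^ j = i then Ark s l else {})"
  using dyadic_val_mod[OF assms] by (auto simp: Ark_eq)

section \<open>Bernoulli mass of cylinders, and measures determined by cylinders\<close>

lemma sets_bern [simp]: "sets bern = sets XN"
  unfolding bern_def XN_def by (rule sets_PiM_cong) auto

lemma space_bern [simp]: "space bern = UNIV"
  using sets_eq_imp_space_eq[OF sets_bern] by simp

lemma prob_space_bern: "prob_space bern"
  unfolding bern_def by (intro prob_space_PiM measure_pmf.prob_space_axioms)

lemma emeasure_bern_Ark:
  assumes "s < 2 ^ l"
  shows "emeasure bern (Ark s l) = ennreal ((1/2) ^ l)"
proof -
  obtain b where b: "dyadic_val l b = s" using ex_dyadic_val assms by blast
  \<comment> \<open>A residue modulo \<open>2 ^ l\<close> fixes exactly the first \<open>l\<close>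
    digits, so its level set is the cylinder through any representative \<open>b\<close>.\<close>
  have Ark: "Ark s l = prod_emb UNIV (\<lambda>_. measure_pmf (bernoulli_pmf (1/2))) {..<l} (\<Pi>\<^sub>E i\<in>{..<l}. {b i})"
  proof (rule set_eqI)
    show "a \<in> Ark s l \<longleftrightarrow>
        a \<in> prod_emb UNIV (\<lambda>_. measure_pmf (bernoulli_pmf (1/2))) {..<l} (\<Pi>\<^sub>E i\<in>{..<l}. {b i})" for a
      using dyadic_val_eq_iff[of l a b] b by (simp add: Ark_eq prod_emb_iff PiE_iff Ball_def)
  qed
  have single: "emeasure (measure_pmf (bernoulli_pmf (1/2))) {b i} = ennreal (1/2)" for i
    by (cases "b i") (auto simp: emeasure_pmf_single)
  have "emeasure bern (Ark s l) = (\<Prod>i<l. emeasure (measure_pmf (bernoulli_pmf (1/2))) {b i})"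
    unfolding bern_def Ark by (rule emeasure_PiM_emb) (auto intro: measure_pmf.prob_space_axioms)
  then show ?thesis
    by (simp only: single prod_constant card_lessThan) (rule ennreal_power, simp)
qed

text \<open>A set depending on finitely many digits is a finite disjoint union of sets
  \<open>Ark s l\<close> for one sufficiently large \<open>l\<close>. As \<open>l\<close> may be
  increased freely, agreement from some level \<open>j\<close> on is enough.\<close>

lemma measure_eqI_Ark:
  assumes sets: "sets M = sets XN" "sets N = sets XN" and fin: "finite_measure M"
    and eq: "\<And>l s. j \<le> l \<Longrightarrow> s < 2 ^ l \<Longrightarrow> emeasure M (Ark s l) = emeasure N (Ark s l)"
  shows "M = N"
proof (rule measure_eqI_PiM_infinite)
  show "sets M = PiM UNIV (\<lambda>_. count_space UNIV)" "sets N = PiM UNIV (\<lambda>_. count_space UNIV)"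
    using sets by (auto simp: XN_def)
  fix A :: "nat \<Rightarrow> bool set" and J :: "nat set"
  assume J: "finite J"
  define B where "B = prod_emb UNIV (\<lambda>_::nat. count_space (UNIV::bool set)) J (Pi\<^sub>E J A)"
  have B: "B = {a. \<forall>i\<in>J. a i \<in> A i}" by (auto simp: B_def prod_emb_def PiE_iff)
  \<comment> \<open>\<open>insert 0 J\<close> keeps the maximum meaningful when \<open>J\<close> is
    empty.\<close>
  define l where "l = max j (Suc (Max (insert 0 J)))"
  have l: "i < l" if "i \<in> J" for i
    using J that Max_ge[of "insert 0 J" i] by (simp add: l_def less_max_iff_disj less_Suc_eq_le del: Max_ge)
  have jl: "j \<le> l" by (simp add: l_def)
  have closed: "b \<in> B" if "a \<in> B" "dyadic_val l a = dyadic_val l b" for a b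
    using that l by (auto simp: B dyadic_val_eq_iff)
  define S where "S = dyadic_val l ` B"
  have S: "S \<subseteq> {..<2 ^ l}" using dyadic_val_less by (auto simp: S_def)
  have fS: "finite S" using S finite_subset by blast
  have BS: "B = (\<Union>s\<in>S. Ark s l)" using closed by (force simp: S_def Ark_eq)
  have disj: "disjoint_family_on (\<lambda>s. Ark s l) S"
    unfolding disjoint_family_on_def using Ark_disjoint by auto
  have "emeasure M B = (\<Sum>s\<in>S. emeasure M (Ark s l))"
    unfolding BS using fS disj sets by (intro sum_emeasure[symmetric]) auto
  also have "\<dots> = (\<Sum>s\<in>S. emeasure N (Ark s l))"
    using eq[OF jl] S by (intro sum.cong) auto
  also have "\<dots> = emeasure N B"
    unfolding BS using fS disj sets by (intro sum_emeasure) auto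
  finally show "emeasure M (prod_emb UNIV (\<lambda>_. count_space UNIV) J (Pi\<^sub>E J A)) =
    emeasure N (prod_emb UNIV (\<lambda>_. count_space UNIV) J (Pi\<^sub>E J A))"
    by (simp add: B_def)
qed (rule fin)

section \<open>Two ergodic measures are equal or mutually singular\<close>

text \<open>Cut \<open>X\<close> into countably many disjoint pieces, each inside one
  \<open>C j\<close>, and sum the inequalities.\<close>

lemma emeasure_le_on_UN_int:
  fixes C :: "int \<Rightarrow> 'a set"
  assumes sets: "sets Q = sets P" and C: "\<And>j. C j \<in> sets P"
    and le: "\<And>j X. X \<in> sets P \<Longrightarrow> X \<subseteq> C j \<Longrightarrow> emeasure Q X \<le> emeasure P X"
    and X: "X \<in> sets P" "X \<subseteq> (\<Union>j. C j)"
  shows "emeasure Q X \<le> emeasure P X"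
proof -
  define F where "F n = X \<inter> C (int_decode n)" for n
  have F: "F n \<in> sets P" for n using X C by (auto simp: F_def)
  have D: "range (disjointed F) \<subseteq> sets P" using F by (intro sets.range_disjointed_sets) auto
  have "(\<Union>n. F n) = X"
    using X(2) by (auto simp: F_def) (metis UN_E int_encode_inverse subsetD)
  then have un: "(\<Union>n. disjointed F n) = X" by (simp add: UN_disjointed_eq)
  have "emeasure Q X = (\<Sum>n. emeasure Q (disjointed F n))"
    using D sets by (subst suminf_emeasure) (auto simp: un disjoint_family_disjointed)
  also have "\<dots> \<le> (\<Sum>n. emeasure P (disjointed F n))"
  proof (intro suminf_le le)
    show "disjointed F n \<in> sets P" for n using D by auto
    show "disjointed F n \<subseteq> C (int_decode n)" for n
      using disjointed_subset[of F n] by (auto simp: F_def)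
  qed auto
  also have "\<dots> = emeasure P X"
    using D by (subst suminf_emeasure) (auto simp: un disjoint_family_disjointed)
  finally show ?thesis .
qed

text \<open>The union of all translates of a Hahn set for \<open>P - Q\<close> is again a Hahn set,
  and it is strictly invariant.\<close>

lemma ergodic_measures_equal_or_singular:
  fixes T :: "int \<Rightarrow> 'a \<Rightarrow> 'a"
  assumes fin: "finite_measure P" "finite_measure Q"
    and sets: "sets Q = sets P" and space: "space P = UNIV"
    and total: "emeasure P UNIV = emeasure Q UNIV"
    and T: "\<And>j. T j \<in> measurable P P" "\<And>i j x. T i (T j x) = T (i + j) x" "\<And>x. T 0 x = x"
    and invP: "\<And>j X. X \<in> sets P \<Longrightarrow> emeasure P (T j -` X) = emeasure P X"
    and invQ: "\<And>j X. X \<in> sets P \<Longrightarrow> emeasure Q (T j -` X) = emeasure Q X"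
    and ergP: "\<And>D. D \<in> sets P \<Longrightarrow> (\<And>j. T j -` D = D) \<Longrightarrow>
      emeasure P D = 0 \<or> emeasure P D = emeasure P UNIV"
    and ergQ: "\<And>D. D \<in> sets P \<Longrightarrow> (\<And>j. T j -` D = D) \<Longrightarrow>
      emeasure Q D = 0 \<or> emeasure Q D = emeasure Q UNIV"
  shows "P = Q \<or> mutually_singular P Q"
proof -
  interpret P: finite_measure P by fact
  interpret Q: finite_measure Q by fact
  have Tset: "T j -` X \<in> sets P" if "X \<in> sets P" for j X
    using measurable_sets[OF T(1)[of j] that] space by simp
  have UNIV [simp]: "UNIV \<in> sets P" using sets.top[of P] space by simp
  have spaceQ: "space Q = UNIV" using sets_eq_imp_space_eq[OF sets] space by simp
  obtain Y where Y: "Y \<in> sets P" and pos: "\<And>X. X \<in> sets P \<Longrightarrow> X \<subseteq> Y \<Longrightarrow> emeasure Q X \<le> emeasure P X"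
    and neg: "\<And>X. X \<in> sets P \<Longrightarrow> X \<inter> Y = {} \<Longrightarrow> emeasure P X \<le> emeasure Q X"
    using finite_unsigned_Hahn_decomposition[OF fin sets] by blast
  define D where "D = (\<Union>j. T j -` Y)"
  have D: "D \<in> sets P" unfolding D_def using Y Tset by auto
  have Tvim: "T i -` (T j -` X) = T (j + i) -` X" for i j X using T(2) by auto
  have Dinv: "T j -` D = D" for j
  proof -
    have "T j -` D = (\<Union>i. T (i + j) -` Y)" by (simp add: D_def vimage_UN Tvim)
    also have "\<dots> = D" unfolding D_def by (auto intro!: exI[of _ "_ - j"])
    finally show ?thesis .
  qed
  \<comment> \<open>Moving \<open>X\<close> back by \<open>-j\<close> puts it inside the Hahn set
    \<open>Y\<close> and changes neither measure.\<close>
  have pos_translate: "emeasure Q X \<le> emeasure P X" if "X \<in> sets P" "X \<subseteq> T j -` Y" for X j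
  proof -
    have "T (-j) -` X \<subseteq> Y" using that(2) T(2)[of j "-j"] T(3) by auto
    with pos[of "T (-j) -` X"] that show ?thesis by (simp add: Tset invP invQ)
  qed
  have posD: "emeasure Q X \<le> emeasure P X" if "X \<in> sets P" "X \<subseteq> D" for X
    using emeasure_le_on_UN_int[of Q P "\<lambda>j. T j -` Y" X] sets Y Tset pos_translate that
    by (simp add: D_def)
  have YD: "Y \<subseteq> D" using T(3) by (auto simp: D_def intro!: exI[of _ 0])
  have negD: "emeasure P X \<le> emeasure Q X" if "X \<in> sets P" "X \<inter> D = {}" for X
    using neg that YD by blast
  show ?thesis
  proof (cases "emeasure P D = emeasure Q D")
    case True
    have "emeasure P X = emeasure Q X" if X: "X \<in> sets P" for X
    proof -
      have XQ [simp]: "X \<in> sets Q" "D \<in> sets Q" "UNIV \<in> sets Q" using X D sets by auto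
      \<comment> \<open>\<open>D\<close> and its complement each have equal mass under both
        measures, so the inequalities on the four pieces cut out by \<open>X\<close> and
        \<open>D\<close> must all be equalities.\<close>
      have le: "measure Q (X \<inter> D) \<le> measure P (X \<inter> D)" "measure Q (D - X) \<le> measure P (D - X)"
        "measure P (X - D) \<le> measure Q (X - D)" "measure P (- D - X) \<le> measure Q (- D - X)"
        using posD[of "X \<inter> D"] posD[of "D - X"] negD[of "X - D"] negD[of "- D - X"] X D space
          sets.compl_sets[OF D]
        by (auto simp: P.emeasure_eq_measure Q.emeasure_eq_measure Compl_eq_Diff_UNIV)
      have split: "measure M D = measure M (X \<inter> D) + measure M (D - X)"
        "measure M (- D) = measure M (X - D) + measure M (- D - X)"
        "measure M UNIV = measure M D + measure M (- D)"
        "measure M X = measure M (X \<inter> D) + measure M (X - D)"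
        if M: "finite_measure M" "sets M = sets P" for M
      proof -
        interpret M: finite_measure M by fact
        have [simp]: "X \<in> sets M" "D \<in> sets M" "- D \<in> sets M"
          using X D M(2) sets.compl_sets[OF D] space by (auto simp: Compl_eq_Diff_UNIV)
        show "measure M D = measure M (X \<inter> D) + measure M (D - X)"
          by (subst M.finite_measure_Union[symmetric]) (auto intro!: arg_cong[where f = "measure M"])
        show "measure M (- D) = measure M (X - D) + measure M (- D - X)"
          by (subst M.finite_measure_Union[symmetric]) (auto intro!: arg_cong[where f = "measure M"])
        show "measure M UNIV = measure M D + measure M (- D)"
          by (subst M.finite_measure_Union[symmetric]) (auto intro!: arg_cong[where f = "measure M"])
        show "measure M X = measure M (X \<inter> D) + measure M (X - D)"
          by (subst M.finite_measure_Union[symmetric]) (auto intro!: arg_cong[where f = "measure M"])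
      qed
      have "measure P D = measure Q D" "measure P UNIV = measure Q UNIV"
        using True total by (simp_all add: measure_def)
      then have "measure P X = measure Q X"
        using le split[OF fin(1) refl] split[OF fin(2) sets] by linarith
      then show ?thesis by (simp add: P.emeasure_eq_measure Q.emeasure_eq_measure)
    qed
    then have "P = Q" using sets by (intro measure_eqI) auto
    then show ?thesis ..
  next
    case False
    \<comment> \<open>Ergodicity leaves only zero or full mass for \<open>D\<close>. The totals
      agree and \<open>Q\<close> is at most \<open>P\<close> on \<open>D\<close>, so distinct values
      mean that \<open>D\<close> is full for \<open>P\<close> and null for \<open>Q\<close>.\<close>
    then have PD: "emeasure P D = emeasure P UNIV" and QD: "emeasure Q D = 0"
      using ergP[OF D Dinv] ergQ[OF D Dinv] posD[OF D] total by auto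
    have "emeasure P (UNIV - D) = 0"
      using emeasure_Diff[of P D UNIV] D PD by simp
    moreover have "UNIV - D \<in> sets P" using D by auto
    moreover have "emeasure Q (space Q - (UNIV - D)) = 0" using QD by (simp add: spaceQ Diff_Diff_Int)
    ultimately have "mutually_singular P Q" unfolding mutually_singular_def by blast
    then show ?thesis ..
  qed
qed

section \<open>Arithmetic of powers of two\<close>

lemma ex_multiple_mod_power2:
  fixes d :: nat
  assumes "0 < d" "d < 2 ^ l"
  shows "\<exists>m. (m * d) mod 2 ^ l = 2 ^ (l - 1)"
proof -
  obtain u where d: "d = 2 ^ multiplicity 2 d * u" "odd u"
    using multiplicity_decompose'[of d 2] assms(1) by auto
  define v where "v = multiplicity 2 d"
  note d = d[folded v_def]
  have "(2::nat) ^ v < 2 ^ l" using d assms by (metis dvd_triv_left dvd_imp_le le_less_trans)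
  then have v: "v < l" by simp
  obtain w where u: "u = 2 * w + 1" using d(2) oddE by blast
  \<comment> \<open>The multiplier raises the 2-part of \<open>d\<close> to
    \<open>2 ^ (l - 1)\<close>. The odd factor \<open>u\<close> then adds only a multiple of
    \<open>2 ^ l\<close>.\<close>
  have "2 ^ (l - 1 - v) * d = 2 ^ (l - 1 - v + v) * u" by (subst d(1)) (simp add: power_add)
  also have "\<dots> = 2 ^ (l - 1) + 2 * 2 ^ (l - 1) * w" using v by (simp add: u algebra_simps)
  also have "2 * 2 ^ (l - 1) = (2::nat) ^ l" using v by (simp flip: power_Suc)
  finally have "(2 ^ (l - 1 - v) * d) mod 2 ^ l = 2 ^ (l - 1)" using v by simp
  then show ?thesis by blast
qed

lemma power2_times_half: "2 ^ l * ennreal ((1/2) ^ l) = 1"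
proof -
  have "2 ^ l * ennreal ((1/2) ^ l) = ennreal (2 ^ l) * ennreal ((1/2) ^ l)"
    by (simp add: ennreal_power[symmetric])
  also have "\<dots> = ennreal (2 ^ l * (1/2) ^ l)"
    by (rule ennreal_mult[symmetric]) auto
  also have "2 ^ l * (1/2) ^ l = (1 :: real)" by (simp add: power_divide)
  finally show ?thesis by simp
qed

lemma divide_power_half: "x / ennreal ((1/2) ^ k) = 2 ^ k * x"
proof -
  have "inverse (ennreal ((1/2) ^ k)) = ennreal (2 ^ k)"
    by (subst inverse_ennreal) (auto simp: power_divide)
  then show ?thesis by (simp add: divide_ennreal_def mult.commute ennreal_power[symmetric])
qed

section \<open>Slices of an invariant measure\<close>

locale invariant_measure =
  fixes \<nu> :: "((int \<Rightarrow> bool) \<times> (nat \<Rightarrow> bool)) measure"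
  assumes MM: "\<nu> \<in> MM"
begin

lemma sets_nu [simp, measurable_cong]: "sets \<nu> = sets (XZ \<Otimes>\<^sub>M XN)"
  using MM by (simp add: MM_def)

lemma space_nu [simp]: "space \<nu> = UNIV"
  using sets_eq_imp_space_eq[OF sets_nu] by (simp add: space_pair_measure)

sublocale prob_space \<nu>
  using MM by (simp add: MM_def)

lemma emeasure_TSO_vimage:
  assumes "C \<in> sets \<nu>"
  shows "emeasure \<nu> (TSO -` C) = emeasure \<nu> C"
proof -
  have "emeasure \<nu> C = emeasure (distr \<nu> (XZ \<Otimes>\<^sub>M XN) TSO) C"
    using MM by (simp add: MM_def)
  also have "\<dots> = emeasure \<nu> (TSO -` C)"
    using assms by (subst emeasure_distr) (auto simp: measurable_cong_sets[OF sets_nu refl])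
  finally show ?thesis ..
qed

text \<open>The projection \<open>Proj r k \<nu>\<close> before normalisation.\<close>

definition slice :: "nat \<Rightarrow> nat \<Rightarrow> (int \<Rightarrow> bool) measure" where
  "slice k r = distr (density \<nu> (indicator (UNIV \<times> Ark r k))) XZ fst"

lemma sets_slice [simp, measurable_cong]: "sets (slice k r) = sets XZ"
  and space_slice [simp]: "space (slice k r) = UNIV"
  by (simp_all add: slice_def)

lemma UNIV_Times_sets [measurable]: "B \<in> sets XN \<Longrightarrow> UNIV \<times> B \<in> sets (XZ \<Otimes>\<^sub>M XN)"
  by (rule pair_measureI) (use sets.top[of XZ] in auto)

lemma emeasure_slice:
  assumes D: "D \<in> sets XZ"
  shows "emeasure (slice k r) D = emeasure \<nu> (D \<times> Ark r k)"
proof -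
  have "emeasure (slice k r) D = emeasure (density \<nu> (indicator (UNIV \<times> Ark r k))) (fst -` D)"
    unfolding slice_def using D by (subst emeasure_distr) auto
  also have "fst -` D = D \<times> (UNIV :: (nat \<Rightarrow> bool) set)" by auto
  also have "emeasure (density \<nu> (indicator (UNIV \<times> Ark r k))) \<dots> =
      emeasure \<nu> ((UNIV \<times> Ark r k) \<inter> (D \<times> UNIV))"
    using D sets.top[of XN] by (intro emeasure_restricted) (auto intro!: pair_measureI)
  also have "(UNIV \<times> Ark r k) \<inter> (D \<times> UNIV) = D \<times> Ark r k" by auto
  finally show ?thesis .
qed

lemma finite_measure_slice: "finite_measure (slice k r)"
  by (rule finite_measureI) (use sets.top[of XZ] in \<open>simp add: emeasure_slice\<close>)

section \<open>Action of the shift on slices, and their total mass\<close>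

lemma slice_shift_Suc:
  assumes "D \<in> sets XZ" "r < 2 ^ k"
  shows "emeasure (slice k r) (shift_by 1 -` D) = emeasure (slice k (Suc r mod 2 ^ k)) D"
proof -
  have "TSO -` (D \<times> Ark (Suc r mod 2 ^ k) k) = (shift_by 1 -` D) \<times> Ark r k"
    using odo_in_Ark_iff[OF assms(2)] by (auto simp: TSO_def shiftS_eq)
  then show ?thesis
    using emeasure_TSO_vimage[of "D \<times> Ark (Suc r mod 2 ^ k) k"] assms
    by (simp add: emeasure_slice shift_by_vimage_sets)
qed

lemma slice_shift:
  assumes "D \<in> sets XZ" "r < 2 ^ k"
  shows "emeasure (slice k r) (shift_by (int n) -` D) = emeasure (slice k ((r + n) mod 2 ^ k)) D"
  using assms(1)
proof (induction n arbitrary: D)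
  case 0
  then show ?case using assms(2) by simp
next
  case (Suc n)
  have "shift_by (int (Suc n)) -` D = shift_by (int n) -` (shift_by 1 -` D)"
    by (simp add: vimage_shift_by_add add.commute)
  also have "emeasure (slice k r) \<dots> = emeasure (slice k ((r + n) mod 2 ^ k)) (shift_by 1 -` D)"
    using Suc by (simp add: shift_by_vimage_sets)
  also have "\<dots> = emeasure (slice k (Suc ((r + n) mod 2 ^ k) mod 2 ^ k)) D"
    using Suc.prems by (intro slice_shift_Suc) auto
  finally show ?case by (simp add: mod_Suc_eq)
qed

lemma slice_invariant:
  assumes D: "D \<in> sets XZ" and r: "r < 2 ^ k"
  shows "emeasure (slice k r) (shift_by (j * 2 ^ k) -` D) = emeasure (slice k r) D"
proof (cases "j \<ge> 0")
  case True
  then have "j * 2 ^ k = int (nat j * 2 ^ k)" by simp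
  then show ?thesis using slice_shift[OF D r, of "nat j * 2 ^ k"] r by simp
next
  case False
  \<comment> \<open>For negative \<open>j\<close>, the forward case is applied to the preimage under
    the backward shift, and the two shifts cancel.\<close>
  have "emeasure (slice k r) (shift_by (int (nat (-j) * 2 ^ k)) -` (shift_by (j * 2 ^ k) -` D)) =
      emeasure (slice k r) (shift_by (j * 2 ^ k) -` D)"
    by (subst slice_shift) (use D r in \<open>auto intro: shift_by_vimage_sets\<close>)
  moreover have "shift_by (int (nat (-j) * 2 ^ k)) -` (shift_by (j * 2 ^ k) -` D) = D"
    using False unfolding vimage_shift_by_add by (simp add: algebra_simps vimage_def)
  ultimately show ?thesis by simp
qed

lemma slice_split:
  assumes D: "D \<in> sets XZ" and r: "r < 2 ^ k"
  shows "emeasure (slice k r) D = emeasure (slice (Suc k) r) D + emeasure (slice (Suc k) (r + 2 ^ k)) D"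
proof -
  have "D \<times> Ark r k = D \<times> Ark r (Suc k) \<union> D \<times> Ark (r + 2 ^ k) (Suc k)"
    using Ark_split[OF r] by blast
  moreover have "(D \<times> Ark r (Suc k)) \<inter> (D \<times> Ark (r + 2 ^ k) (Suc k)) = {}"
    using Ark_disjoint[of r "r + 2 ^ k" "Suc k"] by auto
  ultimately show ?thesis
    using D by (simp add: emeasure_slice plus_emeasure)
qed

lemma slice_total:
  assumes "r < 2 ^ k"
  shows "emeasure (slice k r) UNIV = ennreal ((1/2) ^ k)"
  using assms
proof (induction k arbitrary: r)
  case 0
  have "Ark 0 0 = UNIV" by (auto simp: Ark_eq)
  then show ?case using 0 emeasure_space_1 sets.top[of XZ] by (simp add: emeasure_slice)
next
  case (Suc k)
  interpret f: finite_measure "slice (Suc k) r" by (rule finite_measure_slice)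
  have U: "UNIV \<in> sets XZ" using sets.top[of XZ] by simp
  \<comment> \<open>Adding \<open>2 ^ k\<close> modulo \<open>2 ^ Suc k\<close> carries one half of
    a slice to the other, so both halves have the same mass.\<close>
  have same: "emeasure (slice (Suc k) s) UNIV = emeasure (slice (Suc k) (s + 2 ^ k)) UNIV" if "s < 2 ^ k" for s
    using slice_shift[OF U, of s "Suc k" "2 ^ k"] that by simp
  define s where "s = r mod 2 ^ k"
  have s: "s < 2 ^ k" by (simp add: s_def)
  have "r = s \<or> r = s + 2 ^ k" using Suc.prems by (auto simp: s_def mod_if)
  then have "emeasure (slice (Suc k) r) UNIV + emeasure (slice (Suc k) r) UNIV = ennreal ((1/2) ^ k)"
    using slice_split[OF U s] same[OF s] Suc.IH[OF s] by auto
  then have "ennreal (measure (slice (Suc k) r) UNIV + measure (slice (Suc k) r) UNIV) = ennreal ((1/2) ^ k)"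
    by (subst ennreal_plus) (simp_all add: f.emeasure_eq_measure)
  then have "measure (slice (Suc k) r) UNIV = (1/2) ^ Suc k" by (subst (asm) ennreal_inj) auto
  then show ?case by (simp only: f.emeasure_eq_measure)
qed

lemma emeasure_eq_sum_slices:
  assumes C: "C \<in> sets \<nu>"
  shows "emeasure \<nu> C = (\<Sum>s<2^k. emeasure \<nu> (C \<inter> (UNIV \<times> Ark s k)))"
proof -
  have "C = (\<Union>s\<in>{..<2^k}. C \<inter> (UNIV \<times> Ark s k))"
    using dyadic_val_less[of k] by (auto simp: Ark_eq)
  also have "emeasure \<nu> \<dots> = (\<Sum>s<2^k. emeasure \<nu> (C \<inter> (UNIV \<times> Ark s k)))"
    using C Ark_disjoint[of _ _ k] UNIV_Times_sets[OF Ark_sets]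
    by (intro sum_emeasure[symmetric]) (auto simp: disjoint_family_on_def)
  finally show ?thesis .
qed

text \<open>A set invariant under the \<open>2^k\<close>-th power of the shift, placed over \<open>Ark r k\<close>, is spread by
  the dynamics to a \<open>TSO\<close>-invariant set with the same mass over every \<open>Ark s k\<close>.\<close>

lemma slice_ergodic:
  assumes erg: "ergodic_SO \<nu>" and r: "r < 2 ^ k" and D: "D \<in> sets XZ"
    and inv: "shift_by (2 ^ k) -` D = D"
  shows "emeasure (slice k r) D = 0 \<or> emeasure (slice k r) D = emeasure (slice k r) UNIV"
proof -
  interpret f: finite_measure "slice k r" by (rule finite_measure_slice)
  \<comment> \<open>The exponent is a number of steps leading from the residue of \<open>a\<close>
    to \<open>r\<close> modulo \<open>2 ^ k\<close>; the summand \<open>2 ^ k\<close> keeps the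
    subtraction of naturals from truncating.\<close>
  define C where "C = {(x, a). shift_by (int (r + 2 ^ k - dyadic_val k a)) x \<in> D}"
  have C_slice: "C \<inter> (UNIV \<times> Ark s k) = (shift_by (int (r + 2 ^ k - s)) -` D) \<times> Ark s k" for s
    by (auto simp: C_def Ark_eq)
  have C: "C \<in> sets \<nu>"
  proof -
    have "C = (\<Union>s\<in>{..<2^k}. C \<inter> (UNIV \<times> Ark s k))"
      using dyadic_val_less[of k] by (auto simp: Ark_eq)
    also have "\<dots> \<in> sets \<nu>"
      unfolding C_slice using D by (intro sets.finite_UN) (auto intro!: pair_measureI shift_by_vimage_sets)
    finally show ?thesis .
  qed
  have mass: "emeasure \<nu> (C \<inter> (UNIV \<times> Ark s k)) = emeasure (slice k r) D" if "s < 2 ^ k" for s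
  proof -
    have "emeasure \<nu> (C \<inter> (UNIV \<times> Ark s k)) = emeasure (slice k s) (shift_by (int (r + 2 ^ k - s)) -` D)"
      unfolding C_slice using D by (simp add: emeasure_slice shift_by_vimage_sets)
    also have "\<dots> = emeasure (slice k ((s + (r + 2 ^ k - s)) mod 2 ^ k)) D"
      by (rule slice_shift[OF D that])
    also have "(s + (r + 2 ^ k - s)) mod 2 ^ k = r" using that r by simp
    finally show ?thesis .
  qed
  have invD: "shift_by (2 ^ k + i) x \<in> D \<longleftrightarrow> shift_by i x \<in> D" for i x
    using inv by (metis shift_by_add vimage_eq)
  have TSO_iff: "TSO (x, a) \<in> C \<longleftrightarrow> (x, a) \<in> C" for x a
  proof -
    let ?v = "dyadic_val k a"
    have v: "?v < 2 ^ k" by (rule dyadic_val_less)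
    have "TSO (x, a) \<in> C \<longleftrightarrow> shift_by (int (r + 2 ^ k - Suc ?v mod 2 ^ k) + 1) x \<in> D"
      by (simp add: C_def TSO_def shiftS_eq shift_by_add dyadic_val_odo)
    also have "\<dots> \<longleftrightarrow> shift_by (int (r + 2 ^ k - ?v)) x \<in> D"
    proof (cases "Suc ?v = 2 ^ k")
      \<comment> \<open>Here the residue wraps to zero and the exponent is too large by
        \<open>2 ^ k\<close>, which the invariance of \<open>D\<close> absorbs.\<close>
      case True
      then have "r + 2 ^ k - ?v = Suc r" by simp
      then have "int (r + 2 ^ k - Suc ?v mod 2 ^ k) + 1 = 2 ^ k + int (r + 2 ^ k - ?v)"
        by (simp add: True)
      then show ?thesis by (simp only: invD)
    next
      case False
      then have "Suc ?v < 2 ^ k" using v by simp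
      then have "int (r + 2 ^ k - Suc ?v mod 2 ^ k) + 1 = int (r + 2 ^ k - ?v)"
        by (simp add: of_nat_diff)
      then show ?thesis by simp
    qed
    finally show ?thesis by (simp add: C_def)
  qed
  have "TSO -` C \<inter> space \<nu> = C" using TSO_iff by (intro set_eqI) (simp add: split_paired_all)
  with erg C have "emeasure \<nu> C = 0 \<or> emeasure \<nu> C = 1" unfolding ergodic_SO_def by blast
  moreover have "emeasure \<nu> C = 2 ^ k * emeasure (slice k r) D"
    using emeasure_eq_sum_slices[OF C, of k] mass by simp
  then have "emeasure \<nu> C = ennreal (2 ^ k * measure (slice k r) D)"
    by (simp add: f.emeasure_eq_measure ennreal_mult ennreal_power[symmetric])
  ultimately have "2 ^ k * measure (slice k r) D = 0 \<or> 2 ^ k * measure (slice k r) D = 1"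
    by (auto simp: ennreal_eq_0_iff mult_le_0_iff measure_le_0_iff power_le_zero_eq)
  then have "measure (slice k r) D = 0 \<or> measure (slice k r) D = (1/2) ^ k" by (auto simp: field_simps power_divide)
  then show ?thesis using slice_total[OF r] by (simp only: f.emeasure_eq_measure) auto
qed

text \<open>The dichotomy above applies to the action of the integers by powers of the
  \<open>2 ^ k\<close>-th shift: slices of one level are invariant and ergodic for it and have the
  same total mass.\<close>

lemma slices_equal_or_singular:
  assumes erg: "ergodic_SO \<nu>" and r: "r1 < 2 ^ k" "r2 < 2 ^ k"
  shows "slice k r1 = slice k r2 \<or> mutually_singular (slice k r1) (slice k r2)"
proof (rule ergodic_measures_equal_or_singular[where T = "\<lambda>j. shift_by (j * 2 ^ k)"])
  show "emeasure (slice k r1) UNIV = emeasure (slice k r2) UNIV"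
    using r by (simp add: slice_total)
  have inv: "shift_by (2 ^ k) -` D = D" if "\<And>j. shift_by (j * 2 ^ k) -` D = D" for D
    using that[of 1] by simp
  show "emeasure (slice k r1) D = 0 \<or> emeasure (slice k r1) D = emeasure (slice k r1) UNIV"
    if "D \<in> sets (slice k r1)" "\<And>j. shift_by (j * 2 ^ k) -` D = D" for D
    using slice_ergodic[OF erg r(1)] inv that by simp
  show "emeasure (slice k r2) D = 0 \<or> emeasure (slice k r2) D = emeasure (slice k r2) UNIV"
    if "D \<in> sets (slice k r1)" "\<And>j. shift_by (j * 2 ^ k) -` D = D" for D
    using slice_ergodic[OF erg r(2)] inv that by simp
qed (use r in \<open>auto simp: finite_measure_slice shift_by_add slice_invariant algebra_simps
      measurable_cong_sets[OF sets_slice sets_slice]\<close>)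

section \<open>Coincidences of slices: refinement, periods and scaling\<close>

lemma equal_slices_refine:
  assumes erg: "ergodic_SO \<nu>" and r: "r1 < 2 ^ l" "r2 < 2 ^ l" "r1 \<noteq> r2"
    and eq: "slice l r1 = slice l r2"
  shows "\<exists>s<2 ^ Suc l. s \<noteq> r1 \<and> slice (Suc l) r1 = slice (Suc l) s"
proof (rule ccontr)
  assume "\<not> ?thesis"
  then have no: "\<forall>s. s < 2 ^ Suc l \<longrightarrow> s \<noteq> r1 \<longrightarrow> slice (Suc l) r1 \<noteq> slice (Suc l) s" by blast
  \<comment> \<open>The finer slice at \<open>r1\<close> would be singular to both halves of
    \<open>slice l r2\<close>, hence to their sum. That sum equals \<open>slice l r1\<close>, which
    dominates the finer slice at \<open>r1\<close>; so the latter would vanish, although its total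
    mass is positive.\<close>
  have "mutually_singular (slice (Suc l) r1) (slice (Suc l) r2)"
    using slices_equal_or_singular[OF erg, of r1 "Suc l" r2] no[rule_format, of r2] r by auto
  then obtain C1 where C1: "C1 \<in> sets XZ" "emeasure (slice (Suc l) r1) C1 = 0"
      "emeasure (slice (Suc l) r2) (UNIV - C1) = 0"
    by (auto simp: mutually_singular_def)
  have "mutually_singular (slice (Suc l) r1) (slice (Suc l) (r2 + 2 ^ l))"
    using slices_equal_or_singular[OF erg, of r1 "Suc l" "r2 + 2 ^ l"] no[rule_format, of "r2 + 2 ^ l"] r by auto
  then obtain C2 where C2: "C2 \<in> sets XZ" "emeasure (slice (Suc l) r1) C2 = 0"
      "emeasure (slice (Suc l) (r2 + 2 ^ l)) (UNIV - C2) = 0"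
    by (auto simp: mutually_singular_def)
  have U: "UNIV \<in> sets XZ" using sets.top[of XZ] by simp
  let ?R = "UNIV - (C1 \<union> C2)"
  have R: "?R \<in> sets XZ" using U C1 C2 by auto
  have "emeasure (slice (Suc l) r2) ?R = 0" "emeasure (slice (Suc l) (r2 + 2 ^ l)) ?R = 0"
    by (rule emeasure_eq_0[OF _ C1(3)], use C1 U in auto)
       (rule emeasure_eq_0[OF _ C2(3)], use C2 U in auto)
  then have "emeasure (slice l r1) ?R = 0" using slice_split[OF R r(2)] eq by simp
  then have R0: "emeasure (slice (Suc l) r1) ?R = 0" using slice_split[OF R r(1)] by simp
  have "C1 \<union> C2 \<union> ?R \<in> null_sets (slice (Suc l) r1)"
    using C1 C2 R R0 by (intro null_sets.Un) (auto simp: null_sets_def)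
  moreover have "C1 \<union> C2 \<union> ?R = UNIV" by auto
  ultimately show False using slice_total[of r1 "Suc l"] r by (simp add: null_sets_def)
qed

lemma equal_slices_at_finer_levels:
  assumes erg: "ergodic_SO \<nu>" and r: "r1 < 2 ^ k" "r2 < 2 ^ k" "r1 \<noteq> r2"
    and eq: "slice k r1 = slice k r2" and kl: "k \<le> l"
  shows "\<exists>s1 s2. s1 < 2 ^ l \<and> s2 < 2 ^ l \<and> s1 \<noteq> s2 \<and> slice l s1 = slice l s2"
  using kl
proof (induction l rule: dec_induct)
  case base
  then show ?case using r eq by blast
next
  case (step l)
  then obtain s1 s2 where s: "s1 < 2 ^ l" "s2 < 2 ^ l" "s1 \<noteq> s2" "slice l s1 = slice l s2" by blast
  then have "s1 < 2 ^ Suc l" by simp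
  with equal_slices_refine[OF erg s] show ?case by metis
qed

lemma slice_period:
  assumes s: "s1 < s2" "s2 < 2 ^ l" and eq: "slice l s1 = slice l s2" and t: "t < 2 ^ l"
  shows "slice l ((t + m * (s2 - s1)) mod 2 ^ l) = slice l t"
proof (induction m)
  case 0
  then show ?case using t by simp
next
  case (Suc m)
  have step: "slice l ((u + (s2 - s1)) mod 2 ^ l) = slice l u" if u: "u < 2 ^ l" for u
  proof (rule measure_eqI)
    fix D assume "D \<in> sets (slice l ((u + (s2 - s1)) mod 2 ^ l))"
    then have D: "D \<in> sets XZ" by simp
    \<comment> \<open>\<open>n\<close> steps lead from \<open>s1\<close> to \<open>u\<close> modulo
      \<open>2 ^ l\<close>, and the same number leads from \<open>s2\<close> to
      \<open>u + (s2 - s1)\<close>; the added \<open>2 ^ l\<close> prevents truncation.\<close>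
    define n where "n = u + 2 ^ l - s1"
    have "(s1 + n) mod 2 ^ l = u" using s u by (simp add: n_def)
    moreover have "s2 + n = u + (s2 - s1) + 2 ^ l" using s by (simp add: n_def)
    then have "(s2 + n) mod 2 ^ l = (u + (s2 - s1)) mod 2 ^ l" by (metis mod_add_self2)
    ultimately show "emeasure (slice l ((u + (s2 - s1)) mod 2 ^ l)) D = emeasure (slice l u) D"
      using slice_shift[OF D, of s1 l n] slice_shift[OF D, of s2 l n] s eq by simp
  qed simp
  have "(t + Suc m * (s2 - s1)) mod 2 ^ l = ((t + m * (s2 - s1)) mod 2 ^ l + (s2 - s1)) mod 2 ^ l"
    by (simp add: mod_add_left_eq add.assoc add.commute[of "s2 - s1"])
  then show ?case using step[of "(t + m * (s2 - s1)) mod 2 ^ l"] Suc by simp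
qed

text \<open>The periods form a nontrivial subgroup of the cyclic group of order
  \<open>2 ^ l\<close>, and every such subgroup contains the element \<open>2 ^ (l - 1)\<close> of
  order two.\<close>

lemma slice_half_period:
  assumes s: "s1 < 2 ^ l" "s2 < 2 ^ l" "s1 \<noteq> s2" and eq: "slice l s1 = slice l s2" and t: "t < 2 ^ l"
  shows "slice l ((t + 2 ^ (l - 1)) mod 2 ^ l) = slice l t"
  using s eq
proof (induction s1 s2 rule: linorder_wlog)
  case (le s1 s2)
  then have lt: "s1 < s2" "s2 < 2 ^ l" by auto
  then obtain m where m: "(m * (s2 - s1)) mod 2 ^ l = 2 ^ (l - 1)"
    using ex_multiple_mod_power2[of "s2 - s1" l] less_imp_diff_less[of s2 "2 ^ l" s1] by auto
  have "(t + m * (s2 - s1)) mod 2 ^ l = (t + 2 ^ (l - 1)) mod 2 ^ l"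
    by (metis m mod_add_right_eq)
  then show ?case using slice_period[OF lt _ t, of m] le by simp
qed auto

text \<open>A coincidence at level \<open>Suc l\<close> makes the two halves of every slice of level
  \<open>l\<close> equal, so each refinement contributes a factor 2. The induction starts at
  \<open>k - 1\<close> because the coincidence at level \<open>k\<close> already equates the halves
  of slices of level \<open>k - 1\<close>.\<close>

lemma slice_of_coarser:
  assumes erg: "ergodic_SO \<nu>" and r: "r1 < 2 ^ k" "r2 < 2 ^ k" "r1 \<noteq> r2"
    and eq: "slice k r1 = slice k r2" and l: "k - 1 \<le> l" and s: "s < 2 ^ l" and D: "D \<in> sets XZ"
  shows "emeasure (slice (k - 1) (s mod 2 ^ (k - 1))) D = 2 ^ (l - (k - 1)) * emeasure (slice l s) D"
  using l s
proof (induction l arbitrary: s rule: dec_induct)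
  case base
  then show ?case by simp
next
  case (step l)
  \<comment> \<open>Level 0 has a single residue, which excludes two distinct ones.\<close>
  have "k > 0" using r by (cases k) auto
  then have "k \<le> Suc l" using step by auto
  from equal_slices_at_finer_levels[OF erg r eq this]
  obtain s1 s2 where s12: "s1 < 2 ^ Suc l" "s2 < 2 ^ Suc l" "s1 \<noteq> s2" "slice (Suc l) s1 = slice (Suc l) s2"
    by blast
  define t where "t = s mod 2 ^ l"
  have t: "t < 2 ^ l" by (simp add: t_def)
  have "s = t \<or> s = t + 2 ^ l" using step.prems by (auto simp: t_def mod_if)
  moreover have "slice (Suc l) (t + 2 ^ l) = slice (Suc l) t"
    using slice_half_period[OF s12, of t] t by simp
  ultimately have "emeasure (slice l t) D = 2 * emeasure (slice (Suc l) s) D"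
    using slice_split[OF D t] by (auto simp: mult_2)
  moreover have "s mod 2 ^ (k - 1) = t mod 2 ^ (k - 1)"
    using step.hyps by (simp add: t_def mod_mod_cancel le_imp_power_dvd)
  ultimately show ?case
    using step.IH[OF t] step.hyps by (simp add: Suc_diff_le mult.assoc mult.left_commute)
qed

section \<open>Normalised projections and reconstruction of a periodic measure\<close>

lemma emeasure_Proj_eq:
  assumes D: "D \<in> sets XZ"
  shows "emeasure (Proj r k \<nu>) D = emeasure (slice k r) D / emeasure (slice k r) UNIV"
proof -
  have U: "UNIV \<in> sets XZ" using sets.top[of XZ] by simp
  let ?A = "UNIV \<times> Ark r k :: ((int \<Rightarrow> bool) \<times> (nat \<Rightarrow> bool)) set"
  have A [measurable]: "?A \<in> sets \<nu>" using UNIV_Times_sets[OF Ark_sets] by simp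
  have F [measurable]: "fst -` D \<in> sets \<nu>"
    using measurable_sets[OF measurable_fst[of XZ XN] D] by (simp add: space_pair_measure)
  have "emeasure (Proj r k \<nu>) D =
      emeasure (density \<nu> (\<lambda>z. indicator ?A z / emeasure \<nu> ?A)) (fst -` D)"
    unfolding Proj_def using D by (subst emeasure_distr) simp_all
  also have "\<dots> = (\<integral>\<^sup>+z. indicator ?A z / emeasure \<nu> ?A * indicator (fst -` D) z \<partial>\<nu>)"
    by (rule emeasure_density) (use F in auto)
  also have "\<dots> = (\<integral>\<^sup>+z. indicator (D \<times> Ark r k) z / emeasure \<nu> ?A \<partial>\<nu>)"
    by (rule nn_integral_cong) (auto simp: indicator_def)
  also have "\<dots> = emeasure \<nu> (D \<times> Ark r k) / emeasure \<nu> ?A"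
    using D by (subst nn_integral_divide) auto
  finally show ?thesis by (simp add: emeasure_slice D U)
qed

lemma sets_Proj [simp]: "sets (Proj r k \<nu>) = sets XZ"
  and space_Proj [simp]: "space (Proj r k \<nu>) = UNIV"
  by (simp_all add: Proj_def)

lemma emeasure_Proj:
  assumes "D \<in> sets XZ" "r < 2 ^ k"
  shows "emeasure (Proj r k \<nu>) D = 2 ^ k * emeasure (slice k r) D"
  using assms by (simp only: emeasure_Proj_eq slice_total divide_power_half)

text \<open>For fixed \<open>A\<close> and \<open>i\<close> both sides are measures in
  \<open>B\<close> living on \<open>Ark i j\<close>. The scaling hypothesis makes them agree on all
  cylinders of level at least \<open>j\<close>, which determines them.\<close>

lemma emeasure_Times_Int_Ark:
  assumes slices: "\<And>l s. j \<le> l \<Longrightarrow> s < 2 ^ l \<Longrightarrow>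
      emeasure (slice j (s mod 2 ^ j)) A = 2 ^ (l - j) * emeasure (slice l s) A"
    and A: "A \<in> sets XZ" and B: "B \<in> sets XN"
  shows "emeasure \<nu> (A \<times> (Ark i j \<inter> B)) = 2 ^ j * emeasure (slice j i) A * emeasure bern (Ark i j \<inter> B)"
proof -
  let ?M = "distr (density \<nu> (indicator (A \<times> Ark i j))) XN snd"
  let ?N = "scale_measure (2 ^ j * emeasure (slice j i) A) (density bern (indicator (Ark i j)))"
  have M: "emeasure ?M B = emeasure \<nu> (A \<times> (Ark i j \<inter> B))" if B: "B \<in> sets XN" for B
  proof -
    have vim: "snd -` B \<in> sets (XZ \<Otimes>\<^sub>M XN)"
      using measurable_sets[OF measurable_snd[of XZ XN] B] by (simp add: space_pair_measure)
    have "emeasure ?M B = emeasure (density \<nu> (indicator (A \<times> Ark i j))) (snd -` B)"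
      using B by (subst emeasure_distr) auto
    also have "\<dots> = emeasure \<nu> ((A \<times> Ark i j) \<inter> snd -` B)"
      using A vim by (intro emeasure_restricted) auto
    also have "(A \<times> Ark i j) \<inter> snd -` B = A \<times> (Ark i j \<inter> B)" by auto
    finally show ?thesis .
  qed
  have N: "emeasure ?N B = 2 ^ j * emeasure (slice j i) A * emeasure bern (Ark i j \<inter> B)"
    if B: "B \<in> sets XN" for B
    using B by (simp add: emeasure_restricted)
  have "?M = ?N"
  proof (rule measure_eqI_Ark)
    show "finite_measure ?M"
      by (rule finite_measureI) (use M[OF sets.top] in simp)
    show "emeasure ?M (Ark s l) = emeasure ?N (Ark s l)" if l: "j \<le> l" and s: "s < 2 ^ l" for s l
    proof (cases "s mod 2 ^ j = i")
      case True
      have "Ark i j \<inter> Ark s l = Ark s l" using Ark_inter_coarser[OF l, of s i] True by (simp add: Int_commute)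
      moreover have "2 ^ j * emeasure (slice j i) A * ennreal ((1/2) ^ l) =
          (2 ^ l * ennreal ((1/2) ^ l)) * emeasure (slice l s) A"
        using slices[OF l s] True l power_add[of "2::ennreal" j "l - j"] by (simp add: ac_simps)
      ultimately show ?thesis
        unfolding M[OF Ark_sets] N[OF Ark_sets]
        by (simp only: emeasure_bern_Ark[OF s] power2_times_half emeasure_slice[OF A] mult_1)
    next
      case False
      have "Ark i j \<inter> Ark s l = {}" using Ark_inter_coarser[OF l, of s i] False by (simp add: Int_commute)
      then show ?thesis unfolding M[OF Ark_sets] N[OF Ark_sets] by simp
    qed
  qed auto
  then show ?thesis using M[OF B] N[OF B] by simp
qed

lemma periodic_typeI:
  assumes slices: "\<And>l s A. j \<le> l \<Longrightarrow> s < 2 ^ l \<Longrightarrow> A \<in> sets XZ \<Longrightarrow>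
      emeasure (slice j (s mod 2 ^ j)) A = 2 ^ (l - j) * emeasure (slice l s) A"
  shows "periodic_type \<nu>"
proof -
  \<comment> \<open>The normalised slice over residue 0 is the base measure: its \<open>i\<close>-th
    shift is the normalised slice over \<open>i\<close>, and \<open>2 ^ j\<close> shifts return to
    residue 0.\<close>
  define \<eta> where "\<eta> = Proj 0 j \<nu>"
  have sets_eta [simp, measurable_cong]: "sets \<eta> = sets XZ" and space_eta: "space \<eta> = UNIV"
    by (simp_all add: \<eta>_def)
  have U: "UNIV \<in> sets XZ" using sets.top[of XZ] by simp
  have prob: "prob_space \<eta>"
  proof (rule prob_spaceI)
    show "emeasure \<eta> (space \<eta>) = 1"
      unfolding space_eta unfolding \<eta>_def
      by (simp only: emeasure_Proj[OF U] slice_total zero_less_power zero_less_numeral power2_times_half)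
  qed
  have shift: "emeasure (distr \<eta> XZ (shiftS ^^ i)) A = 2 ^ j * emeasure (slice j (i mod 2 ^ j)) A"
    if A: "A \<in> sets XZ" for A i
  proof -
    have "emeasure (distr \<eta> XZ (shiftS ^^ i)) A = emeasure \<eta> (shift_by (int i) -` A)"
      using A by (subst emeasure_distr) (auto simp: shiftS_funpow space_eta)
    also have "\<dots> = 2 ^ j * emeasure (slice j (i mod 2 ^ j)) A"
      using slice_shift[OF A, of 0 j i] A by (simp add: \<eta>_def emeasure_Proj shift_by_vimage_sets)
    finally show ?thesis .
  qed
  have inv: "distr \<eta> XZ (shiftS ^^ (2 ^ j)) = \<eta>"
    using shift by (intro measure_eqI) (auto simp: \<eta>_def emeasure_Proj)
  \<comment> \<open>Each summand of \<open>Dk_emeasure\<close> is \<nu> restricted to one residue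
    class; product measures are determined by rectangles.\<close>
  have pair: "distr \<eta> XZ (shiftS ^^ i) \<Otimes>\<^sub>M density bern (indicator (Ark i j)) =
      density \<nu> (indicator (UNIV \<times> Ark i j))" if i: "i < 2 ^ j" for i
  proof (rule pair_measure_eqI)
    interpret eta: prob_space \<eta> by (rule prob)
    have "prob_space (distr \<eta> XZ (shiftS ^^ i))"
      by (rule eta.prob_space_distr) (simp add: shiftS_funpow)
    then show "sigma_finite_measure (distr \<eta> XZ (shiftS ^^ i))"
      by (rule prob_space_imp_sigma_finite)
    interpret bern: prob_space bern by (rule prob_space_bern)
    have "finite_measure (density bern (indicator (Ark i j)))"
      by (rule finite_measureI) (use sets.top[of XN] in \<open>simp add: emeasure_restricted\<close>)
    then show "sigma_finite_measure (density bern (indicator (Ark i j)))"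
      by (simp add: finite_measure_def)
    show "sets (distr \<eta> XZ (shiftS ^^ i) \<Otimes>\<^sub>M density bern (indicator (Ark i j))) =
        sets (density \<nu> (indicator (UNIV \<times> Ark i j)))"
      by (simp cong: sets_pair_measure_cong)
    fix A B assume "A \<in> sets (distr \<eta> XZ (shiftS ^^ i))" "B \<in> sets (density bern (indicator (Ark i j)))"
    then have A: "A \<in> sets XZ" and B: "B \<in> sets XN" by auto
    have "emeasure (density \<nu> (indicator (UNIV \<times> Ark i j))) (A \<times> B) =
        emeasure \<nu> ((UNIV \<times> Ark i j) \<inter> (A \<times> B))"
      using A B UNIV_Times_sets[OF Ark_sets] by (intro emeasure_restricted) auto
    also have "(UNIV \<times> Ark i j) \<inter> (A \<times> B) = A \<times> (Ark i j \<inter> B)" by auto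
    also have "emeasure \<nu> \<dots> = 2 ^ j * emeasure (slice j i) A * emeasure bern (Ark i j \<inter> B)"
      using slices A by (intro emeasure_Times_Int_Ark A B) auto
    finally show "emeasure (distr \<eta> XZ (shiftS ^^ i)) A *
        emeasure (density bern (indicator (Ark i j))) B =
        emeasure (density \<nu> (indicator (UNIV \<times> Ark i j))) (A \<times> B)"
      using shift[OF A, of i] i B by (simp add: emeasure_restricted)
  qed
  have "emeasure \<nu> C = Dk_emeasure j \<eta> C" if C: "C \<in> sets (XZ \<Otimes>\<^sub>M XN)" for C
  proof -
    have "emeasure \<nu> C = (\<Sum>i<2^j. emeasure \<nu> (C \<inter> (UNIV \<times> Ark i j)))"
      using C by (intro emeasure_eq_sum_slices) simp
    also have "\<dots> = Dk_emeasure j \<eta> C"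
      unfolding Dk_emeasure_def using C UNIV_Times_sets[OF Ark_sets]
      by (intro sum.cong) (auto simp: pair emeasure_restricted Int_commute)
    finally show ?thesis .
  qed
  then show ?thesis unfolding periodic_type_def using prob inv sets_eta by blast
qed

end

theorem theorem3:
  assumes "\<nu> \<in> MM" and "ergodic_SO \<nu>" and "aperiodic \<nu>"
  shows "\<forall>k r1 r2. r1 < 2^k \<and> r2 < 2^k \<and> r1 \<noteq> r2 \<longrightarrow>
           mutually_singular (Proj r1 k \<nu>) (Proj r2 k \<nu>)"
proof (intro allI impI, elim conjE)
  fix k r1 r2 :: nat
  assume r: "r1 < 2 ^ k" "r2 < 2 ^ k" "r1 \<noteq> r2"
  interpret invariant_measure \<nu> by unfold_locales (rule assms(1))
  have "slice k r1 \<noteq> slice k r2"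
  proof
    assume "slice k r1 = slice k r2"
    \<comment> \<open>The scaling relation holds from level \<open>k - 1\<close> on, which serves as
      the level of the periodic form.\<close>
    then have "periodic_type \<nu>"
      using slice_of_coarser[OF assms(2) r] by (intro periodic_typeI) blast
    with assms(3) show False by (simp add: aperiodic_def)
  qed
  with slices_equal_or_singular[OF assms(2) r(1,2)]
  obtain C where C: "C \<in> sets XZ" "emeasure (slice k r1) C = 0" "emeasure (slice k r2) (UNIV - C) = 0"
    by (auto simp: mutually_singular_def)
  moreover have "UNIV - C \<in> sets XZ" using C(1) sets.compl_sets[of C XZ] by simp
  \<comment> \<open>Each projection is its slice scaled by \<open>2 ^ k\<close>, so the same set
    \<open>C\<close> separates the two.\<close>
  ultimately show "mutually_singular (Proj r1 k \<nu>) (Proj r2 k \<nu>)"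
    unfolding mutually_singular_def using r by (intro bexI[of _ C]) (auto simp: emeasure_Proj)
qed

end
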